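(* Let $M\ge 2$ be an even integer, let $m\ge 1$ be an integer with $m\le 2M-3$, let $\mathbf a,\mathbf b_1,\dots,\mathbf b_m\in\mathbb C^{M}$, let $\mathbf P\in\mathbb C^{M\times M}$ be Hermitian positive definite, let $c\in[0,1]$, and let $k_{\max}\ge 1$ be an integer. Assume the standing assumptions listed in the context (nonzero reference entries, full column rank of $[\mathbf\Lambda_1\mid\mathbf\Lambda_2]$, and well-defined output interaural transfer functions of the computed iterates). Run the iterative method described in the context with inputs $c,k_{\max},\mathbf a,\mathbf b_1,\dots,\mathbf b_m,\mathbf P$. Then: (a) the method always finds a solution satisfying the stopping criterion in a finite number of iterations $k\le k_{\max}$, i.e. it outputs $\hat{\mathbf w}_{(k)}$ for some $k\in\{0,1,\dots,k_{\max}\}$ with $\mathcal E_{i}(\hat{\mathbf w}_{(k)})\le e_i(c)$ for $i=1,\dots,m$; (b) the output $\hat{\mathbf w}_{(k)}$ has bounded ITF error, $$0\le \mathcal E_{i}(\hat{\mathbf w}_{(k)})\le e_i(c),\qquad i=1,\dots,m,$$ and bounded output noise power, $$\hat{\mathbf w}_{\mathrm{BMVDR}}^H\tilde{\mathbf P}\,\hat{\mathbf w}_{\mathrm{BMVDR}}\;\le\;\hat{\mathbf w}_{(k)}^H\tilde{\mathbf P}\,\hat{\mathbf w}_{(k)}\;\le\;\hat{\mathbf w}_{\mathrm{JBLCMV}}^H\tilde{\mathbf P}\,\hat{\mathbf w}_{\mathrm{JBLCMV}}.$$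
   Context: Notation. For $\mathbf a\in\mathbb C^M$ write $a_L$ for its first entry and $a_R$ for its $M$-th (last) entry; likewise $b_{iL}$ and $b_{iR}$ are the first and last entries of $\mathbf b_i\in\mathbb C^M$. A vector $\mathbf w\in\mathbb C^{2M}$ is split as $\mathbf w=[\mathbf w_L^T\ \mathbf w_R^T]^T$ with $\mathbf w_L,\mathbf w_R\in\mathbb C^M$. $(\cdot)^H$ is the conjugate transpose and $(\cdot)^*$ the complex conjugate. Set $$\tilde{\mathbf P}=\begin{bmatrix}\mathbf P&\mathbf 0\\ \mathbf 0&\mathbf P\end{bmatrix},\qquad \mathbf\Lambda_1=\begin{bmatrix}\mathbf a&\mathbf 0\\ \mathbf 0&\mathbf a\end{bmatrix}\in\mathbb C^{2M\times 2},\qquad \mathbf f_1=\begin{bmatrix}a_L^*\\ a_R^*\end{bmatrix},$$ so $\mathbf w^H\mathbf\Lambda_1=\mathbf f_1^H$ means $\mathbf w_L^H\mathbf a=a_L$ and $\mathbf w_R^H\mathbf a=a_R$. Let $\mathbf\Lambda_2\in\mathbb C^{2M\times m}$ have $i$-th column $$\mathbf\Lambda_{2,i}=\begin{bmatrix}\mathbf b_i b_{iR}\\ -\mathbf b_i b_{iL}\end{bmatrix},\quad\text{so that}\quad \mathbf w^H\mathbf\Lambda_{2,i}=\mathbf w_L^H\mathbf b_i\,b_{iR}-\mathbf w_R^H\mathbf b_i\,b_{iL}.$$ ITF error. For $\mathbf w$ with $\mathbf w_R^H\mathbf b_i\ne0$, the interaural transfer function (ITF) error of interferer $i$ is $$\mathcal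 E_i(\mathbf w)=\left|\frac{\mathbf w_L^H\mathbf b_i}{\mathbf w_R^H\mathbf b_i}-\frac{b_{iL}}{b_{iR}}\right|.$$ Reference filters. - $\hat{\mathbf w}_{\mathrm{BMVDR}}$ is the minimizer of $\mathbf w^H\tilde{\mathbf P}\mathbf w$ over $\mathbf w\in\mathbb C^{2M}$ subject to $\mathbf w^H\mathbf\Lambda_1=\mathbf f_1^H$. Explicitly, its left and right parts are $\mathbf P^{-1}\mathbf a\,a_L^*/(\mathbf a^H\mathbf P^{-1}\mathbf a)$ and $\mathbf P^{-1}\mathbf a\,a_R^*/(\mathbf a^H\mathbf P^{-1}\mathbf a)$. - $\hat{\mathbf w}_{\mathrm{JBLCMV}}$ is the minimizer of $\mathbf w^H\tilde{\mathbf P}\mathbf w$ over $\mathbf w\in\mathbb C^{2M}$ subject to $\mathbf w^H\mathbf\Lambda_1=\mathbf f_1^H$ and $\mathbf w^H\mathbf\Lambda_2=\mathbf 0$. Tolerances. Put $\mathcal E_{i,\mathrm{BMVDR}}=\mathcal E_i(\hat{\mathbf w}_{\mathrm{BMVDR}})=\left|\frac{a_L}{a_R}-\frac{b_{iL}}{b_{iR}}\right|$ and, for $t\ge 0$, $e_i(t)=t\,\mathcal E_{i,\mathrm{BMVDR}}$. Iterative method. Stopping criterion for a vector $\mathbf w$: $\mathcal E_i(\mathbf w)\le e_i(c)$ for all $i=1,\dots,m$ (with the fixed $c$). Set $\hat{\mathbf w}_{(0)}=\hat{\mathbf w}_{\mathrm{BMVDR}}$, $\tau_{(0)}=c$ and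 $\tau_{(k)}=\tau_{(k-1)}-c/k_{\max}$ for $k\ge1$ (so $\tau_{(k_{\max})}=0$). If $\hat{\mathbf w}_{(0)}$ satisfies the stopping criterion, output $\hat{\mathbf w}_{(0)}$ and stop. Otherwise, for $k=1,2,\dots,k_{\max}$: let $\hat{\mathbf w}_{(k)}$ be the minimizer of the convex problem $$\min_{\mathbf w\in\mathbb C^{2M}}\ \mathbf w^H\tilde{\mathbf P}\mathbf w\quad\text{s.t.}\quad \mathbf w^H\mathbf\Lambda_1=\mathbf f_1^H,\quad |\mathbf w^H\mathbf\Lambda_{2,i}|\le\left|e_i(\tau_{(k)})\,\hat{\mathbf w}_{R,(k-1)}^H\mathbf b_i\,b_{iR}\right|,\ i=1,\dots,m,$$ where $\hat{\mathbf w}_{R,(k-1)}$ is the right part of $\hat{\mathbf w}_{(k-1)}$; if $\hat{\mathbf w}_{(k)}$ satisfies the stopping criterion or $k=k_{\max}$, output $\hat{\mathbf w}_{(k)}$ and stop; otherwise continue with $k+1$. Standing assumptions. (i) $a_R\neq 0$ and $b_{iR}\ne0$ for all $i$ (the input ITFs $a_L/a_R$, $b_{iL}/b_{iR}$ are defined). (ii) The matrix $[\mathbf\Lambda_1\mid\mathbf\Lambda_2]\in\mathbb C^{2M\times(2+m)}$ has full column rank. (iii) For every iterate $\hat{\mathbf w}_{(k)}$ computed by the method (including $k=0$) and every $i$, $\hat{\mathbf w}_{R,(k)}^H\mathbf b_i\ne 0$, so that $\mathcal E_i(\hat{\mathbf w}_{(k)})$ is defined. *)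

theory Defs
  imports "HOL-Analysis.Analysis"
begin

text \<open>
  The index type \<open>'n\<close> of the vectors in \<open>\<complex>\<^sup>M\<close> is a finite linear order with \<open>M = CARD('n)\<close> elements,
  so that the first and the last entry of a vector make sense.  Vectors in \<open>\<complex>\<^sup>2\<^sup>M\<close> are indexed by
  the sum type \<open>'n + 'n\<close>: the left part carries the indices \<open>Inl p\<close>, the right part the indices
  \<open>Inr p\<close>.  The interferers are indexed by a finite type \<open>'m\<close> with \<open>m = CARD('m)\<close> elements.
\<close>

type_synonym 'n cvec = "(complex, 'n) vec"
type_synonym 'n cmat = "((complex, 'n) vec, 'n) vec"
type_synonym 'n stacked = "(complex, 'n + 'n) vec"

definition first_entry :: "'n::{finite,linorder} cvec \<Rightarrow> complex" where
  "first_entry v = v $ Min UNIV"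

definition last_entry :: "'n::{finite,linorder} cvec \<Rightarrow> complex" where
  "last_entry v = v $ Max UNIV"

definition left_part :: "'n stacked \<Rightarrow> 'n::finite cvec" where
  "left_part w = (\<chi> p. w $ Inl p)"

definition right_part :: "'n stacked \<Rightarrow> 'n::finite cvec" where
  "right_part w = (\<chi> p. w $ Inr p)"

text \<open>
  \<open>cnj_vec v\<close> holds the entries of the row vector \<open>v\<^sup>H\<close>, so \<open>v\<^sup>H A\<close> is \<open>cnj_vec v v* A\<close>;
  \<open>herm_prod u v\<close> is the scalar \<open>u\<^sup>H v\<close>.
\<close>

definition cnj_vec :: "complex ^ 'k \<Rightarrow> complex ^ 'k" where
  "cnj_vec v = (\<chi> i. cnj (v $ i))"

definition herm_prod :: "complex ^ ('k::finite) \<Rightarrow> complex ^ 'k \<Rightarrow> complex" where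
  "herm_prod u v = (\<Sum>i\<in>UNIV. cnj (u $ i) * v $ i)"

definition hermitian_matrix :: "complex ^ 'k ^ 'k \<Rightarrow> bool" where
  "hermitian_matrix A \<longleftrightarrow> (\<forall>i j. A $ i $ j = cnj (A $ j $ i))"

text \<open>For a Hermitian matrix \<open>A\<close>, \<open>x\<^sup>H A x\<close> is real; hence nothing is lost by taking real parts here
  and in \<open>noise_power\<close>.\<close>

definition hermitian_posdef :: "complex ^ ('k::finite) ^ 'k \<Rightarrow> bool" where
  "hermitian_posdef A \<longleftrightarrow> hermitian_matrix A \<and> (\<forall>x. x \<noteq> 0 \<longrightarrow> Re (herm_prod x (A *v x)) > 0)"

definition P_tilde :: "'n::finite cmat \<Rightarrow> ('n + 'n) cmat" where
  "P_tilde P = (\<chi> i j. case (i, j) of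
      (Inl p, Inl q) \<Rightarrow> P $ p $ q
    | (Inr p, Inr q) \<Rightarrow> P $ p $ q
    | _ \<Rightarrow> 0)"

text \<open>The columns of \<open>Lambda1 a\<close> are indexed by the two-element type \<open>2\<close>, with elements \<open>1\<close> and \<open>2\<close>.\<close>

definition Lambda1 :: "'n::finite cvec \<Rightarrow> complex ^ 2 ^ ('n + 'n)" where
  "Lambda1 a = (\<chi> i j. case i of
      Inl p \<Rightarrow> if j = 1 then a $ p else 0
    | Inr p \<Rightarrow> if j = 2 then a $ p else 0)"

definition f1 :: "'n::{finite,linorder} cvec \<Rightarrow> complex ^ 2" where
  "f1 a = vector [cnj (first_entry a), cnj (last_entry a)]"

definition Lambda2 :: "('m::finite \<Rightarrow> 'n::{finite,linorder} cvec) \<Rightarrow> complex ^ 'm ^ ('n + 'n)" where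
  "Lambda2 b = (\<chi> r i. case r of
      Inl p \<Rightarrow> b i $ p * last_entry (b i)
    | Inr p \<Rightarrow> - (b i $ p * first_entry (b i)))"

definition append_columns :: "complex ^ 'k ^ 'r \<Rightarrow> complex ^ 'l ^ 'r \<Rightarrow> complex ^ ('k + 'l) ^ 'r" where
  "append_columns A B = (\<chi> r j. case j of Inl k \<Rightarrow> A $ r $ k | Inr l \<Rightarrow> B $ r $ l)"

definition noise_power :: "'n::finite cmat \<Rightarrow> 'n stacked \<Rightarrow> real" where
  "noise_power P w = Re (herm_prod w (P_tilde P *v w))"

definition itf_error :: "('m \<Rightarrow> 'n::{finite,linorder} cvec) \<Rightarrow> 'm \<Rightarrow> 'n stacked \<Rightarrow> real" where
  "itf_error b i w =
    cmod (herm_prod (left_part w) (b i) / herm_prod (right_part w) (b i)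
          - first_entry (b i) / last_entry (b i))"

definition w_BMVDR :: "'n cmat \<Rightarrow> 'n cvec \<Rightarrow> 'n::{finite,linorder} stacked" where
  "w_BMVDR P a = arg_min (noise_power P) (\<lambda>w. cnj_vec w v* Lambda1 a = cnj_vec (f1 a))"

definition w_JBLCMV ::
    "'n cmat \<Rightarrow> 'n cvec \<Rightarrow> ('m::finite \<Rightarrow> 'n cvec)
      \<Rightarrow> 'n::{finite,linorder} stacked" where
  "w_JBLCMV P a b = arg_min (noise_power P)
     (\<lambda>w. cnj_vec w v* Lambda1 a = cnj_vec (f1 a) \<and> cnj_vec w v* Lambda2 b = 0)"

definition tolerance ::
    "'n cmat \<Rightarrow> 'n::{finite,linorder} cvec \<Rightarrow> ('m \<Rightarrow> 'n cvec) \<Rightarrow> 'm \<Rightarrow> real \<Rightarrow> real" where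
  "tolerance P a b i t = t * itf_error b i (w_BMVDR P a)"

definition stopping ::
    "'n cmat \<Rightarrow> 'n::{finite,linorder} cvec \<Rightarrow> ('m \<Rightarrow> 'n cvec) \<Rightarrow> real
      \<Rightarrow> 'n stacked \<Rightarrow> bool" where
  "stopping P a b c w \<longleftrightarrow> (\<forall>i. itf_error b i w \<le> tolerance P a b i c)"

primrec tau :: "real \<Rightarrow> nat \<Rightarrow> nat \<Rightarrow> real" where
  "tau c kmax 0 = c"
| "tau c kmax (Suc k) = tau c kmax k - c / real kmax"

text \<open>The constraints of the convex problem with parameter \<open>t\<close>, where \<open>u\<close> is the previous iterate.\<close>

definition feasible ::
    "'n cmat \<Rightarrow> 'n::{finite,linorder} cvec \<Rightarrow> ('m::finite \<Rightarrow> 'n cvec) \<Rightarrow> real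
      \<Rightarrow> 'n stacked \<Rightarrow> 'n stacked \<Rightarrow> bool" where
  "feasible P a b t u w \<longleftrightarrow>
     cnj_vec w v* Lambda1 a = cnj_vec (f1 a) \<and>
     (\<forall>i. cmod (herm_prod w (column i (Lambda2 b)))
          \<le> cmod (of_real (tolerance P a b i t) * herm_prod (right_part u) (b i) * last_entry (b i)))"

text \<open>\<open>iterate P a b c kmax k w\<close>: the method computes an iterate number \<open>k\<close>, and it is \<open>w\<close>.
  In particular no earlier iterate satisfies the stopping criterion, and the convex problems solved
  so far do possess minimizers.\<close>

inductive iterate ::
    "'n cmat \<Rightarrow> 'n::{finite,linorder} cvec \<Rightarrow> ('m::finite \<Rightarrow> 'n cvec) \<Rightarrow> real \<Rightarrow> nat
      \<Rightarrow> nat \<Rightarrow> 'n stacked \<Rightarrow> bool"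
  for P a b c kmax where
  start: "iterate P a b c kmax 0 (w_BMVDR P a)"
| step: "\<lbrakk>iterate P a b c kmax k u; \<not> stopping P a b c u; k < kmax;
          is_arg_min (noise_power P) (feasible P a b (tau c kmax (Suc k)) u) w\<rbrakk>
         \<Longrightarrow> iterate P a b c kmax (Suc k) w"

definition outputs ::
    "'n cmat \<Rightarrow> 'n::{finite,linorder} cvec \<Rightarrow> ('m::finite \<Rightarrow> 'n cvec) \<Rightarrow> real \<Rightarrow> nat
      \<Rightarrow> nat \<Rightarrow> 'n stacked \<Rightarrow> bool" where
  "outputs P a b c kmax k w \<longleftrightarrow> iterate P a b c kmax k w \<and> (stopping P a b c w \<or> k = kmax)"

end

theory Submission
  imports Defs
begin

text \<open>
  Full column rank of \<open>[\<Lambda>\<^sub>1 | \<Lambda>\<^sub>2]\<close> yields a vector satisfying the JBLCMV constraints.  Such a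
  vector is feasible for every convex problem of the method, whatever the previous iterate and
  the tolerance, because it makes the left-hand sides of all inequality constraints vanish.  Hence
  all minimizers exist (a positive definite quadratic form attains its minimum on a nonempty closed
  set), and the JBLCMV noise power bounds that of every iterate.  In the last problem the tolerance
  is zero, so its minimizer satisfies \<open>w\<^sup>H \<Lambda>\<^sub>2 = 0\<close>, i.e. has zero ITF error.
\<close>

section \<open>Sums over stacked indices; coercivity and minimizers of quadratic forms\<close>

lemma sum_UNIV_sum_type:
  fixes f :: "'a::finite + 'b::finite \<Rightarrow> 'c::comm_monoid_add"
  shows "(\<Sum>x\<in>UNIV. f x) = (\<Sum>x\<in>UNIV. f (Inl x)) + (\<Sum>x\<in>UNIV. f (Inr x))"
proof -
  have "(\<Sum>x\<in>UNIV. f x) = (\<Sum>x\<in>range Inl \<union> range Inr. f x)"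
    by (simp add: UNIV_sum)
  also have "\<dots> = sum f (range Inl) + sum f (range Inr)"
    by (rule sum.union_disjoint) auto
  finally show ?thesis
    by (simp add: sum.reindex)
qed

lemma quadratic_form_scaleR:
  "Re (herm_prod (r *\<^sub>R x) (A *v (r *\<^sub>R x))) = r\<^sup>2 * Re (herm_prod x (A *v x))"
proof -
  have "herm_prod (r *\<^sub>R x) (A *v (r *\<^sub>R x)) = of_real (r\<^sup>2) * herm_prod x (A *v x)"
    by (simp add: herm_prod_def matrix_vector_mult_def sum_distrib_left
        scaleR_conv_of_real[where 'a = complex]
        power2_eq_square mult_ac)
  then show ?thesis
    by simp
qed

lemma continuous_on_herm_prod [continuous_intros]:
  assumes "continuous_on S f" "continuous_on S g"
  shows "continuous_on S (\<lambda>x. herm_prod (f x) (g x))"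
  unfolding herm_prod_def by (intro continuous_intros assms)

lemma continuous_on_matrix_vector [continuous_intros]:
  fixes A :: "complex ^ 'k ^ 'l"
  assumes "continuous_on S f"
  shows "continuous_on S (\<lambda>x. A *v f x)"
  unfolding matrix_vector_mult_def by (intro continuous_intros assms)

lemma continuous_on_cnj_vec_vector_matrix [continuous_intros]:
  fixes A :: "complex ^ 'k ^ 'l"
  assumes "continuous_on S f"
  shows "continuous_on S (\<lambda>x. cnj_vec (f x) v* A)"
  unfolding vector_matrix_mult_def cnj_vec_def by (simp, intro continuous_intros assms)

text \<open>The constant is the minimum of the form on the compact unit sphere. It is positive by
  definiteness, and degree-two homogeneity carries the bound to all vectors.\<close>

lemma hermitian_posdef_coercive:
  fixes A :: "complex ^ 'k::finite ^ 'k"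
  assumes "hermitian_posdef A"
  obtains \<mu> where "\<mu> > 0" "\<And>x. \<mu> * (norm x)\<^sup>2 \<le> Re (herm_prod x (A *v x))"
proof -
  let ?q = "\<lambda>x. Re (herm_prod x (A *v x))"
  obtain e :: "complex ^ 'k" where "norm e = 1"
    using vector_choose_size[of 1] by auto
  then have "sphere (0 :: complex ^ 'k) 1 \<noteq> {}"
    by auto
  moreover have "continuous_on (sphere 0 1) ?q"
    by (intro continuous_intros)
  ultimately have "\<exists>u\<in>sphere 0 1. \<forall>x\<in>sphere 0 1. ?q u \<le> ?q x"
    by (rule continuous_attains_inf[OF compact_sphere])
  then obtain u where u: "u \<in> sphere 0 1" "\<And>x. x \<in> sphere 0 1 \<Longrightarrow> ?q u \<le> ?q x"
    by blast
  have "u \<noteq> 0"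
    using u(1) by auto
  then have "?q u > 0"
    using assms by (simp add: hermitian_posdef_def)
  moreover have "?q u * (norm x)\<^sup>2 \<le> ?q x" for x
  proof (cases "x = 0")
    case True
    then show ?thesis
      by (simp add: herm_prod_def)
  next
    case False
    define y where "y = x /\<^sub>R norm x"
    have x: "x = norm x *\<^sub>R y"
      using False by (simp add: y_def)
    have "?q u \<le> ?q y"
      using False by (intro u(2)) (simp add: y_def)
    then have "?q u * (norm x)\<^sup>2 \<le> (norm x)\<^sup>2 * ?q y"
      by (simp add: mult.commute mult_right_mono)
    also have "\<dots> = ?q x"
      using quadratic_form_scaleR[of "norm x" y A] x by simp
    finally show ?thesis .
  qed
  ultimately show ?thesis
    by (rule that)
qed

text \<open>Coercivity bounds the part of the constraint set where the form does not exceed its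
  value at \<open>z\<close>. That part is compact and contains \<open>z\<close>, so the form attains
  its minimum there.\<close>

lemma quadratic_form_attains_inf:
  fixes A :: "complex ^ 'k::finite ^ 'k"
  assumes "hermitian_posdef A" and "closed {w. C w}" and "C z"
  shows "\<exists>w. is_arg_min (\<lambda>w. Re (herm_prod w (A *v w))) C w"
proof -
  let ?q = "\<lambda>x. Re (herm_prod x (A *v x))"
  obtain \<mu> where \<mu>: "\<mu> > 0" "\<And>x. \<mu> * (norm x)\<^sup>2 \<le> ?q x"
    using hermitian_posdef_coercive[OF assms(1)] by blast
  define K where "K = {w. C w} \<inter> {w. ?q w \<le> ?q z}"
  have "norm w \<le> sqrt (?q z / \<mu>)" if "w \<in> K" for w
  proof (rule real_le_rsqrt)
    have "\<mu> * (norm w)\<^sup>2 \<le> ?q z"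
      using \<mu>(2)[of w] that by (auto simp: K_def)
    then show "(norm w)\<^sup>2 \<le> ?q z / \<mu>"
      using \<mu>(1) by (simp add: field_simps)
  qed
  then have "bounded K"
    by (auto simp: bounded_iff)
  moreover have "closed K"
    unfolding K_def by (intro closed_Int assms(2) closed_Collect_le continuous_intros)
  ultimately have "compact K"
    by (simp add: compact_eq_bounded_closed)
  moreover have "z \<in> K"
    using assms(3) by (simp add: K_def)
  moreover have "continuous_on K ?q"
    by (intro continuous_intros)
  ultimately obtain w where w: "w \<in> K" "\<And>x. x \<in> K \<Longrightarrow> ?q w \<le> ?q x"
    using continuous_attains_inf[of K ?q] by blast
  \<comment> \<open>A point outside \<open>K\<close> has a value above that of \<open>z\<close>,
    which in turn is at least that of \<open>w\<close>.\<close>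
  have "?q w \<le> ?q x" if "C x" for x
    using w that by (cases "?q x \<le> ?q z") (auto simp: K_def)
  then show ?thesis
    using w(1) by (auto simp: is_arg_min_linorder K_def)
qed

section \<open>The noise power as a positive definite form\<close>

lemma noise_power_parts:
  "noise_power P w = Re (herm_prod (left_part w) (P *v left_part w))
    + Re (herm_prod (right_part w) (P *v right_part w))"
  by (simp add: noise_power_def herm_prod_def P_tilde_def matrix_vector_mult_def
      sum_UNIV_sum_type left_part_def right_part_def)

lemma hermitian_posdef_P_tilde:
  fixes P :: "'n::finite cmat"
  assumes "hermitian_posdef P"
  shows "hermitian_posdef (P_tilde P)"
  unfolding hermitian_posdef_def
proof (intro conjI allI impI)
  have P: "P $ p $ q = cnj (P $ q $ p)" for p q
    using assms unfolding hermitian_posdef_def hermitian_matrix_def by blast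
  have "P_tilde P $ i $ j = cnj (P_tilde P $ j $ i)" for i j
    by (cases i; cases j) (simp_all add: P_tilde_def P[symmetric])
  then show "hermitian_matrix (P_tilde P)"
    unfolding hermitian_matrix_def by blast
next
  have pos: "Re (herm_prod x (P *v x)) > 0" if "x \<noteq> 0" for x
    using assms that by (simp add: hermitian_posdef_def)
  have nonneg: "Re (herm_prod x (P *v x)) \<ge> 0" for x
    using pos[of x] by (cases "x = 0") (auto simp: herm_prod_def)
  fix w :: "'n stacked"
  assume "w \<noteq> 0"
  then obtain s where "w $ s \<noteq> 0"
    by (auto simp: vec_eq_iff)
  then have "left_part w \<noteq> 0 \<or> right_part w \<noteq> 0"
    by (cases s) (auto simp: vec_eq_iff left_part_def right_part_def)
  then have "noise_power P w > 0"
    unfolding noise_power_parts using pos nonneg by (meson add_pos_nonneg add_nonneg_pos)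
  then show "Re (herm_prod w (P_tilde P *v w)) > 0"
    by (simp add: noise_power_def)
qed

lemma noise_power_attains_inf:
  assumes "hermitian_posdef P" and "closed {w. C w}" and "C z"
  shows "\<exists>w. is_arg_min (noise_power P) C w"
  using quadratic_form_attains_inf[OF hermitian_posdef_P_tilde] assms
  by (auto simp: noise_power_def[abs_def])

text \<open>\<open>arg_min\<close> is a choice operator, so the reference filters are true
  minimizers only once existence is known.\<close>

lemma is_arg_min_arg_min:
  assumes "\<exists>w. is_arg_min f C w"
  shows "is_arg_min f C (arg_min f C)"
  unfolding arg_min_def using assms by (rule someI_ex)

section \<open>Solvability and closedness of the constraints\<close>

lemma full_column_rank_surj:
  fixes A :: "complex ^ 'k ^ 'l"
  assumes "rank A = CARD('k)"
  obtains v where "v v* A = t"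
proof -
  \<comment> \<open>Row rank equals column rank, so the rows span the whole row space. This gives a
    left inverse \<open>B\<close>, and \<open>t v* B\<close> is a solution.\<close>
  have "vec.span (rows A) = UNIV"
    using assms vec.dim_eq_full[of "rows A"]
    by (simp add: row_rank_def_gen card_cart_basis vec.dimension_def)
  then obtain B :: "complex ^ 'l ^ 'k" where "B ** A = mat 1"
    using matrix_left_invertible_span_rows_gen[of A] by auto
  then have "(t v* B) v* A = t"
    by (simp add: vector_matrix_mul_assoc)
  then show ?thesis
    by (rule that)
qed

lemma herm_prod_column: "herm_prod w (column i A) = (cnj_vec w v* A) $ i"
  by (simp add: herm_prod_def column_def vector_matrix_mult_def cnj_vec_def mult.commute)

lemma JBLCMV_feasible:
  fixes a :: "'n::{finite,linorder} cvec" and b :: "'m::finite \<Rightarrow> 'n cvec"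
  assumes "rank (append_columns (Lambda1 a) (Lambda2 b)) = 2 + CARD('m)"
  obtains z where "cnj_vec z v* Lambda1 a = cnj_vec (f1 a)" "cnj_vec z v* Lambda2 b = 0"
proof -
  define t :: "complex ^ (2 + 'm)" where
    "t = (\<chi> j. case j of Inl k \<Rightarrow> cnj_vec (f1 a) $ k | Inr _ \<Rightarrow> 0)"
  obtain v where v: "v v* append_columns (Lambda1 a) (Lambda2 b) = t"
    using full_column_rank_surj[of "append_columns (Lambda1 a) (Lambda2 b)"] assms by auto
  have "(v v* Lambda1 a) $ k = cnj_vec (f1 a) $ k" for k
    using arg_cong[OF v, of "\<lambda>x. x $ Inl k"]
    by (simp add: t_def append_columns_def vector_matrix_mult_def)
  moreover have "(v v* Lambda2 b) $ i = 0" for i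
    using arg_cong[OF v, of "\<lambda>x. x $ Inr i"]
    by (simp add: t_def append_columns_def vector_matrix_mult_def)
  ultimately have "v v* Lambda1 a = cnj_vec (f1 a)" "v v* Lambda2 b = 0"
    by (simp_all add: vec_eq_iff)
  \<comment> \<open>The constraints involve the conjugate of the filter, so the filter sought is the
    conjugate of the solution \<open>v\<close>.\<close>
  moreover have "cnj_vec (cnj_vec v) = v"
    by (simp add: cnj_vec_def vec_eq_iff)
  ultimately show ?thesis
    using that[of "cnj_vec v"] by simp
qed

lemma feasible_if_JBLCMV_feasible:
  assumes "cnj_vec w v* Lambda1 a = cnj_vec (f1 a)" "cnj_vec w v* Lambda2 b = 0"
  shows "feasible P a b t u w"
  using assms by (simp add: feasible_def herm_prod_column)

lemma closed_feasible: "closed {w. feasible P a b t u w}"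
  unfolding feasible_def herm_prod_column
  by (intro closed_Collect_conj closed_Collect_all closed_Collect_le closed_Collect_eq
      continuous_intros)

section \<open>From the constraints to the ITF error\<close>

lemma herm_prod_Lambda2:
  "herm_prod w (column i (Lambda2 b)) = herm_prod (left_part w) (b i) * last_entry (b i)
    - herm_prod (right_part w) (b i) * first_entry (b i)"
  by (simp add: herm_prod_def column_def Lambda2_def sum_UNIV_sum_type left_part_def
      right_part_def sum_distrib_right sum_negf mult.assoc)

text \<open>The constraint value is the numerator of the difference of the two ITFs over their
  common denominator.\<close>

lemma itf_error_eq_0:
  assumes "herm_prod w (column i (Lambda2 b)) = 0"
    and "last_entry (b i) \<noteq> 0" and "herm_prod (right_part w) (b i) \<noteq> 0"
  shows "itf_error b i w = 0"
  using assms by (simp add: herm_prod_Lambda2 itf_error_def field_simps)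

lemma itf_error_nonneg: "0 \<le> itf_error b i w"
  by (simp add: itf_error_def)

section \<open>The tolerance schedule and the iterates\<close>

lemma tau_eq: "tau c kmax k = c - real k * (c / real kmax)"
  by (induction k) (simp_all add: algebra_simps add_divide_distrib)

lemma iterate_le_kmax: "iterate P a b c kmax k w \<Longrightarrow> k \<le> kmax"
  by (induction rule: iterate.induct) auto

text \<open>Forgets how the previous iterate \<open>u\<close> arose: the noise bounds and the final
  step work for any \<open>u\<close>.\<close>

lemma iterate_cases:
  assumes "iterate P a b c kmax k w"
  obtains (BMVDR) "k = 0" "w = w_BMVDR P a"
  | (arg_min) u where "is_arg_min (noise_power P) (feasible P a b (tau c kmax k) u) w"
  using assms by (cases rule: iterate.cases) auto

theorem theorem1:
  fixes P :: "'n::{finite,linorder} cmat" and a :: "'n cvec"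
    and b :: "'m::finite \<Rightarrow> 'n cvec" and c :: real and kmax :: nat
  assumes "CARD('n) \<ge> 2" and "even CARD('n)"
    and "CARD('m) \<ge> 1" and "CARD('m) \<le> 2 * CARD('n) - 3"
    and "hermitian_posdef P"
    and "0 \<le> c" and "c \<le> 1" and "kmax \<ge> 1"
    and "last_entry a \<noteq> 0" and "\<And>i. last_entry (b i) \<noteq> 0"
    and "rank (append_columns (Lambda1 a) (Lambda2 b)) = 2 + CARD('m)"
    and "\<And>k w i. iterate P a b c kmax k w \<Longrightarrow> herm_prod (right_part w) (b i) \<noteq> 0"
  shows "(\<exists>k w. k \<le> kmax \<and> outputs P a b c kmax k w \<and>
            (\<forall>i. itf_error b i w \<le> tolerance P a b i c)) \<and>
         (\<forall>k w. outputs P a b c kmax k w \<longrightarrow>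
            k \<le> kmax \<and>
            (\<forall>i. 0 \<le> itf_error b i w \<and> itf_error b i w \<le> tolerance P a b i c) \<and>
            noise_power P (w_BMVDR P a) \<le> noise_power P w \<and>
            noise_power P w \<le> noise_power P (w_JBLCMV P a b))"
proof -
  obtain z where z: "cnj_vec z v* Lambda1 a = cnj_vec (f1 a)" "cnj_vec z v* Lambda2 b = 0"
    using JBLCMV_feasible[OF assms(11)] by metis
  have BMVDR: "is_arg_min (noise_power P) (\<lambda>w. cnj_vec w v* Lambda1 a = cnj_vec (f1 a)) (w_BMVDR P a)"
    unfolding w_BMVDR_def using assms(5) z(1)
    by (intro is_arg_min_arg_min noise_power_attains_inf closed_Collect_eq continuous_intros)
  have JBLCMV: "is_arg_min (noise_power P)
      (\<lambda>w. cnj_vec w v* Lambda1 a = cnj_vec (f1 a) \<and> cnj_vec w v* Lambda2 b = 0) (w_JBLCMV P a b)"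
    unfolding w_JBLCMV_def using assms(5) z
    by (intro is_arg_min_arg_min noise_power_attains_inf[where z = z] closed_Collect_conj
        closed_Collect_eq continuous_intros conjI)
  have bounds: "noise_power P (w_BMVDR P a) \<le> noise_power P w \<and>
      noise_power P w \<le> noise_power P (w_JBLCMV P a b)" if "iterate P a b c kmax k w" for k w
    using that
  proof (cases rule: iterate_cases)
    case BMVDR': BMVDR
    then show ?thesis
      using BMVDR JBLCMV by (simp add: is_arg_min_linorder)
  next
    case (arg_min u)
    have "feasible P a b (tau c kmax k) u (w_JBLCMV P a b)"
      using JBLCMV by (intro feasible_if_JBLCMV_feasible) (auto simp: is_arg_min_linorder)
    \<comment> \<open>Dropping the inequality constraints gives the lower bound; feasibility of
      \<open>w_JBLCMV P a b\<close> gives the upper one.\<close>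
    then show ?thesis
      using arg_min BMVDR by (auto simp: is_arg_min_linorder feasible_def)
  qed
  have last: "stopping P a b c w" if "iterate P a b c kmax kmax w" for w
    using that
  proof (cases rule: iterate_cases)
    \<comment> \<open>This case would force \<open>kmax = 0\<close>.\<close>
    case BMVDR
    then show ?thesis
      using assms(8) by simp
  next
    case (arg_min u)
    \<comment> \<open>By \<open>tau_eq\<close> the tolerance parameter vanishes at
      \<open>kmax\<close>, so every inequality has right-hand side zero.\<close>
    then have "feasible P a b 0 u w"
      using assms(8) by (simp add: is_arg_min_linorder tau_eq)
    then have "herm_prod w (column i (Lambda2 b)) = 0" for i
      by (simp add: feasible_def tolerance_def)
    then have "itf_error b i w = 0" for i
      using assms(10,12) that by (intro itf_error_eq_0) auto
    then show ?thesis
      using assms(6) by (simp add: stopping_def tolerance_def itf_error_nonneg)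
  qed
  have stop: "stopping P a b c w" if "outputs P a b c kmax k w" for k w
    using that last by (auto simp: outputs_def)
  \<comment> \<open>The first alternative is needed because no further iterate is computed from one
    that meets the stopping criterion.\<close>
  have progress: "(\<exists>j w. outputs P a b c kmax j w) \<or> (\<exists>w. iterate P a b c kmax k w)"
    if "k \<le> kmax" for k
    using that
  proof (induction k)
    case 0
    then show ?case
      using iterate.start by blast
  next
    case (Suc k)
    \<comment> \<open>If iterate \<open>k\<close> meets the stopping criterion, it is itself an
      output.\<close>
    then consider "\<exists>j w. outputs P a b c kmax j w"
      | u where "iterate P a b c kmax k u" "\<not> stopping P a b c u"
      by (auto simp: outputs_def)
    then show ?case
    proof cases
      case 2
      obtain w where "is_arg_min (noise_power P) (feasible P a b (tau c kmax (Suc k)) u) w"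
        using noise_power_attains_inf[OF assms(5) closed_feasible feasible_if_JBLCMV_feasible[OF z]]
        by blast
      then show ?thesis
        using iterate.step 2 Suc.prems by (metis Suc_le_lessD)
    qed simp
  qed
  have le: "k \<le> kmax" if "outputs P a b c kmax k w" for k w
    using that by (auto simp: outputs_def iterate_le_kmax)
  \<comment> \<open>An iterate with index \<open>kmax\<close> is an output by definition, so both
    alternatives of \<open>progress\<close> suffice.\<close>
  have "\<exists>k w. outputs P a b c kmax k w"
    using progress[of kmax] by (auto simp: outputs_def)
  moreover have "\<forall>i. 0 \<le> itf_error b i w \<and> itf_error b i w \<le> tolerance P a b i c"
    if "outputs P a b c kmax k w" for k w
    using stop[OF that] by (simp add: stopping_def itf_error_nonneg)
  moreover have "noise_power P (w_BMVDR P a) \<le> noise_power P w \<and>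
      noise_power P w \<le> noise_power P (w_JBLCMV P a b)" if "outputs P a b c kmax k w" for k w
    using that bounds[of k w] by (simp add: outputs_def)
  ultimately show ?thesis
    using le by meson
qed

end
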